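(* Let $\Delta_1$ and $\Delta_2$ be (finite) simplicial complexes. Suppose that their comparability graphs $G(\Delta_1)$ and $G(\Delta_2)$ are isomorphic as graphs. Then $\Delta_1$ and $\Delta_2$ are isomorphic as simplicial complexes.
   Context: For a positive integer $n$, let $[n]=\{1,2,\ldots,n\}$. A (finite) simplicial complex $\Delta$ on $[n]$ is a system of subsets of $[n]$ such that (a) $\{i\}\in\Delta$ for every $i\in[n]$, and (b) if $E\in\Delta$ and $F\subseteq E$, then $F\in\Delta$. The elements of $\Delta$ are called faces (the empty set is a face), and the faces that are maximal under inclusion are called facets. The vertex set of $\Delta$ is $[n]$. An isomorphism of simplicial complexes $\Delta_1$ (on $[n_1]$) and $\Delta_2$ (on $[n_2]$) is a bijection between their vertex sets such that the image and the inverse image of every face is a face (equivalently, the image and the inverse image of every facet is a facet). The comparability graph $G(\Delta)$ of a simplicial complex $\Delta$ is the simple undirected graph whose vertices are the nonempty faces of $\Delta$, with two distinct nonempty faces $E,F$ joined by an edge if and only if $E\subset F$ or $F\subset E$. (It is the 1-skeleton of the barycentric subdivision of $\Delta$.) *)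

theory Defs
  imports Main
begin

section \<open>Simplicial complexes\<close>

text \<open>Faces are sets of naturals, and the vertex set is \<open>{1..n}\<close> with \<open>n\<close> positive.\<close>

definition simplicial_complex :: "nat \<Rightarrow> nat set set \<Rightarrow> bool" where
  "simplicial_complex n \<Delta> \<longleftrightarrow>
     n \<ge> 1 \<and> \<Delta> \<subseteq> Pow {1..n} \<and> (\<forall>i\<in>{1..n}. {i} \<in> \<Delta>) \<and>
     (\<forall>E\<in>\<Delta>. \<forall>F. F \<subseteq> E \<longrightarrow> F \<in> \<Delta>)"

text \<open>The inverse image of a face is taken within the vertex set \<open>{1..n1}\<close>, since the values
  of \<open>f\<close> outside it are irrelevant.\<close>

definition complex_isomorphism ::
  "nat \<Rightarrow> nat set set \<Rightarrow> nat \<Rightarrow> nat set set \<Rightarrow> (nat \<Rightarrow> nat) \<Rightarrow> bool" where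
  "complex_isomorphism n1 \<Delta>1 n2 \<Delta>2 f \<longleftrightarrow>
     bij_betw f {1..n1} {1..n2} \<and>
     (\<forall>E\<in>\<Delta>1. f ` E \<in> \<Delta>2) \<and>
     (\<forall>F\<in>\<Delta>2. f -` F \<inter> {1..n1} \<in> \<Delta>1)"

definition complex_isomorphic ::
  "nat \<Rightarrow> nat set set \<Rightarrow> nat \<Rightarrow> nat set set \<Rightarrow> bool" where
  "complex_isomorphic n1 \<Delta>1 n2 \<Delta>2 \<longleftrightarrow> (\<exists>f. complex_isomorphism n1 \<Delta>1 n2 \<Delta>2 f)"

section \<open>Simple graphs\<close>

text \<open>A graph is a pair of a vertex set and an edge set, an undirected edge being the
  two-element set of its ends.\<close>

type_synonym 'a graph = "'a set \<times> 'a set set"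

definition simple_graph :: "'a graph \<Rightarrow> bool" where
  "simple_graph G \<longleftrightarrow> (\<forall>e\<in>snd G. e \<subseteq> fst G \<and> card e = 2)"

definition graph_isomorphism :: "'a graph \<Rightarrow> 'b graph \<Rightarrow> ('a \<Rightarrow> 'b) \<Rightarrow> bool" where
  "graph_isomorphism G H f \<longleftrightarrow>
     bij_betw f (fst G) (fst H) \<and>
     (\<forall>x\<in>fst G. \<forall>y\<in>fst G. {x, y} \<in> snd G \<longleftrightarrow> {f x, f y} \<in> snd H)"

definition graph_isomorphic :: "'a graph \<Rightarrow> 'b graph \<Rightarrow> bool" where
  "graph_isomorphic G H \<longleftrightarrow> (\<exists>f. graph_isomorphism G H f)"

definition comparability_graph :: "'a set set \<Rightarrow> 'a set graph" where
  "comparability_graph \<Delta> =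
     (\<Delta> - {{}}, {{E, F} | E F. E \<in> \<Delta> - {{}} \<and> F \<in> \<Delta> - {{}} \<and> (E \<subset> F \<or> F \<subset> E)})"

lemma simple_graph_comparability_graph: "simple_graph (comparability_graph \<Delta>)"
  unfolding simple_graph_def comparability_graph_def by (auto simp: card_2_iff)

end

theory Submission
  imports Defs
begin

text \<open>Let \<open>f\<close> preserve comparability on a connected component of the poset of nonempty faces.
  Two comparabilities \<open>E \<subset> F\<close>, \<open>E' \<subset> F\<close> with \<open>E\<close>, \<open>E'\<close> incomparable are both preserved or both
  reversed by \<open>f\<close>, and likewise with a common lower face. If the component has no largest face,
  these forcing relations link all its comparabilities, so \<open>f\<close> is monotone or antitone there.
  If there is a largest face, the component is a simplex and is determined by its cardinality.
  In the antitone case the star of a vertex \<open>v\<close> is dual to the simplex on \<open>f {v}\<close>; counting faces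
  shows that the link of \<open>v\<close> is the boundary of a simplex. Hence the component is the boundary of
  a simplex or a cycle, and \<open>f\<close> becomes monotone after composition with complementation or with
  a rotation of the barycentric subdivision.\<close>

section \<open>Vocabulary for posets of nonempty faces\<close>

definition comparable :: "'a set \<Rightarrow> 'a set \<Rightarrow> bool" where
  "comparable E F \<longleftrightarrow> E \<subset> F \<or> F \<subset> E"

text \<open>Leaving out the empty face makes each component of the comparability graph again a face
  poset. The empty family is allowed.\<close>

definition face_poset :: "'a set set \<Rightarrow> bool" where
  "face_poset K \<longleftrightarrow> finite K \<and> (\<forall>E\<in>K. finite E \<and> E \<noteq> {} \<and> (\<forall>F. F \<subseteq> E \<longrightarrow> F \<noteq> {} \<longrightarrow> F \<in> K))"

text \<open>Connectedness of the graph of a symmetric \<open>r\<close> on \<open>K\<close>, phrased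
  as an induction principle so that no paths have to be handled.\<close>

definition linked :: "('a \<Rightarrow> 'a \<Rightarrow> bool) \<Rightarrow> 'a set \<Rightarrow> bool" where
  "linked r K \<longleftrightarrow> (\<forall>S. S \<subseteq> K \<longrightarrow> S \<noteq> {} \<longrightarrow> (\<forall>x\<in>S. \<forall>y\<in>K. r x y \<longrightarrow> y \<in> S) \<longrightarrow> S = K)"

text \<open>An order isomorphism with no vertex map presupposed; the vertex map is extracted once
  all components are glued.\<close>

definition face_iso :: "('a set \<Rightarrow> 'b set) \<Rightarrow> 'a set set \<Rightarrow> 'b set set \<Rightarrow> bool" where
  "face_iso g K L \<longleftrightarrow> bij_betw g K L \<and> (\<forall>E\<in>K. \<forall>F\<in>K. g E \<subseteq> g F \<longleftrightarrow> E \<subseteq> F)"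

lemma face_posetD:
  assumes "face_poset K"
  shows "finite K" "E \<in> K \<Longrightarrow> finite E" "E \<in> K \<Longrightarrow> E \<noteq> {}"
    "E \<in> K \<Longrightarrow> F \<subseteq> E \<Longrightarrow> F \<noteq> {} \<Longrightarrow> F \<in> K"
  using assms unfolding face_poset_def by blast+

lemma linkedD:
  assumes "linked r K" "x \<in> K" "P x"
    and "\<And>x y. x \<in> K \<Longrightarrow> y \<in> K \<Longrightarrow> P x \<Longrightarrow> r x y \<Longrightarrow> P y"
    and "y \<in> K"
  shows "P y"
proof -
  have "{x \<in> K. P x} = K"
    using assms(1)[unfolded linked_def, rule_format, of "{x \<in> K. P x}"] assms(2-4) by blast
  then show ?thesis using assms(5) by blast
qed

subsection \<open>Rotating a cycle\<close>

text \<open>A finite connected 2-regular graph is a cycle. A walk that never turns back traverses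
  it, and \<open>r\<close> moves each vertex one step along this walk.\<close>

lemma two_regular_rotation:
  fixes V :: "'a set" and adj :: "'a \<Rightarrow> 'a \<Rightarrow> bool"
  assumes fin: "finite V" and ne: "V \<noteq> {}"
    and sym: "\<And>x y. adj x y \<Longrightarrow> adj y x" and irr: "\<And>x. \<not> adj x x"
    and two: "\<And>x. x \<in> V \<Longrightarrow> card {y \<in> V. adj x y} = 2"
    and link: "linked adj V"
  shows "\<exists>r. bij_betw r V V \<and> (\<forall>x\<in>V. adj x (r x)) \<and>
    (\<forall>x\<in>V. \<forall>y\<in>V. adj (r x) (r y) \<longleftrightarrow> adj x y)"
proof -
  define N where "N x = {y \<in> V. adj x y}" for x
  \<comment> \<open>The walk arriving at \<open>y\<close> from \<open>x\<close> continues to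
    \<open>other x y\<close>.\<close>
  define other where "other x y = (SOME z. z \<in> N y \<and> z \<noteq> x)" for x y
  have other: "N y = {x, other x y} \<and> other x y \<noteq> x" if "y \<in> V" "x \<in> V" "adj x y" for x y
  proof -
    have "x \<in> N y" using that sym by (auto simp: N_def)
    moreover have "card (N y) = 2" using two that by (simp add: N_def)
    ultimately obtain z where z: "N y = {x, z}" "z \<noteq> x"
      by (metis card_2_iff insertE insert_commute singletonD)
    then have "other x y = z" unfolding other_def by (intro some_equality) auto
    then show ?thesis using z by simp
  qed
  obtain x0 where x0: "x0 \<in> V" using ne by auto
  have "card (N x0) = 2" using two[OF x0] by (simp add: N_def)
  then have "N x0 \<noteq> {}" by auto
  then obtain x1 where x1: "x1 \<in> V" "adj x0 x1" by (auto simp: N_def)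
  \<comment> \<open>The next vertex depends on the last two, so the recursion carries a
    pair.\<close>
  define p where "p = rec_nat (x0, x1) (\<lambda>_ (x, y). (y, other x y))"
  define a where "a i = fst (p i)" for i
  have pS: "p (Suc i) = (snd (p i), other (fst (p i)) (snd (p i)))" for i
    by (simp add: p_def split: prod.splits)
  have snd_p: "snd (p i) = a (Suc i)" for i by (simp add: a_def pS)
  have aSS: "a (Suc (Suc i)) = other (a i) (a (Suc i))" for i
    by (metis a_def pS fst_conv snd_conv)
  have a0: "a 0 = x0" by (simp add: a_def p_def)
  have a1: "a (Suc 0) = x1" using snd_p[of 0] by (simp add: p_def)
  have aV: "a i \<in> V \<and> a (Suc i) \<in> V \<and> adj (a i) (a (Suc i))" for i
  proof (induction i)
    case 0
    then show ?case using x0 x1 by (simp add: a0 a1)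
  next
    case (Suc i)
    then have "a (Suc (Suc i)) \<in> N (a (Suc i))"
      using other[of "a (Suc i)" "a i"] by (simp add: aSS)
    then show ?case using Suc by (auto simp: N_def)
  qed
  have NaS: "N (a (Suc i)) = {a i, a (Suc (Suc i))}" and neq2: "a (Suc (Suc i)) \<noteq> a i" for i
    using other[of "a (Suc i)" "a i"] aV[of i] by (auto simp: aSS)
  have neq1: "a (Suc i) \<noteq> a i" for i using aV[of i] irr by metis
  have "\<exists>n j. j < n \<and> a j = a n"
  proof (rule ccontr)
    assume *: "\<not> ?thesis"
    have "inj a"
      by (rule linorder_injI) (use * in blast)
    then have "infinite (range a)" using finite_imageD by blast
    moreover have "range a \<subseteq> V" using aV by auto
    ultimately show False using fin finite_subset by blast
  qed
  \<comment> \<open>\<open>n\<close> is the first time at which the walk meets an earlier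
    vertex.\<close>
  then obtain n where n: "\<exists>j<n. a j = a n" and least: "\<And>m. m < n \<Longrightarrow> \<not> (\<exists>j<m. a j = a m)"
    using exists_least_iff[of "\<lambda>n. \<exists>j<n. a j = a n"] by blast
  have inj: "i = j" if "a i = a j" "i < n" "j < n" for i j
    using that least by (metis linorder_neqE_nat)
  obtain j where j: "j < n" "a j = a n" using n by auto
  have n3: "n \<ge> 3"
  proof (rule ccontr)
    assume "\<not> ?thesis"
    then have "n = 0 \<or> n = 1 \<or> n = 2" by auto
    then show False
      using j neq1[of 0] neq1[of 1] neq2[of 0] by (auto simp: less_Suc_eq numeral_2_eq_2)
  qed
  then obtain m where m: "n = Suc (Suc (Suc m))"
    using le_Suc_ex[of 3 n] by (auto simp: numeral_3_eq_3)
  \<comment> \<open>If the walk returned to \<open>a j\<close> with \<open>j > 0\<close>, then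
    \<open>a (n - 1)\<close> would be a neighbour of \<open>a j\<close>, hence its predecessor or
    successor on the walk. This contradicts the minimality of \<open>n\<close>, or yields a loop or
    a backward turn.\<close>
  have j0: "j = 0"
  proof (rule ccontr)
    assume "j \<noteq> 0"
    then obtain i where i: "j = Suc i" using not0_implies_Suc by blast
    have "a (Suc (Suc m)) \<in> N (a n)" using NaS[of "Suc (Suc m)"] m by auto
    then have "a (Suc (Suc m)) \<in> {a i, a (Suc (Suc i))}" using NaS[of i] j i by simp
    then consider "a (Suc (Suc m)) = a i" | "a (Suc (Suc m)) = a (Suc (Suc i))" by auto
    then show False
    proof cases
      case 1
      then show ?thesis using inj[of "Suc (Suc m)" i] j i m by auto
    next
      case 2
      have "Suc (Suc i) < n \<or> Suc (Suc i) = n" using i j by auto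
      then show ?thesis
      proof
        assume "Suc (Suc i) < n"
        then have "Suc (Suc m) = Suc (Suc i)" using inj[OF 2] m by auto
        then show False using j i m neq2[of j] by simp
      next
        assume "Suc (Suc i) = n"
        then show False using 2 m neq1[of "Suc (Suc m)"] by auto
      qed
    qed
  qed
  have an: "a n = a 0" using j j0 by simp
  \<comment> \<open>Two consecutive values determine the walk, so periodicity is proved for pairs.
    At the start, \<open>a 1\<close> is a neighbour of \<open>a n = a 0\<close> other than
    \<open>a (n - 1)\<close>, since \<open>n \<ge> 3\<close>; so it is
    \<open>a (n + 1)\<close>.\<close>
  have per2: "a (i + n) = a i \<and> a (Suc i + n) = a (Suc i)" for i
  proof (induction i)
    case 0
    have "a 1 \<in> N (a n)" using an aV[of 0] by (auto simp: N_def)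
    then have "a 1 \<in> {a (Suc (Suc m)), a (Suc n)}" using NaS[of "Suc (Suc m)"] m by simp
    moreover have "a 1 \<noteq> a (Suc (Suc m))" using inj[of 1 "Suc (Suc m)"] m by auto
    ultimately show ?case using an by auto
  next
    case (Suc i)
    then show ?case using aSS[of i] aSS[of "i + n"] by simp
  qed
  have per: "a (i mod n) = a i" for i
  proof -
    have "a (i + k * n) = a i" for i k
    proof (induction k)
      case (Suc k)
      have "i + Suc k * n = (i + k * n) + n" by simp
      then show ?case using per2 Suc by metis
    qed simp
    from this[of "i mod n" "i div n"] show ?thesis by simp
  qed
  have npos: "0 < n" using m by simp
  have a_eq: "a i = a j \<longleftrightarrow> i mod n = j mod n" for i j
  proof
    assume "a i = a j"
    then have "a (i mod n) = a (j mod n)" by (simp only: per)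
    then show "i mod n = j mod n" using inj npos by (meson mod_less_divisor)
  next
    assume "i mod n = j mod n"
    then show "a i = a j" using per[of i] per[of j] by simp
  qed
  have a_eqS: "a (Suc i) = a (Suc j) \<longleftrightarrow> a i = a j" for i j
    unfolding a_eq
  proof
    assume "i mod n = j mod n"
    then show "Suc i mod n = Suc j mod n" by (simp add: mod_Suc)
  next
    assume "Suc i mod n = Suc j mod n"
    then have "(Suc i + (n - 1)) mod n = (Suc j + (n - 1)) mod n" by (rule mod_add_cong) simp
    moreover have "Suc k + (n - 1) = k + n" for k using npos by simp
    ultimately show "i mod n = j mod n" by (simp only: mod_add_self2)
  qed
  have pred: "\<exists>k. a i = a (Suc k)" for i
  proof -
    have "a i = a (Suc (i + Suc (Suc m)))" using per2[of i] m by simp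
    then show ?thesis by blast
  qed
  have all: "\<exists>i. y = a i" if "y \<in> V" for y
  proof (rule linkedD[OF link x0, of "\<lambda>y. \<exists>i. y = a i"])
    show "\<exists>i. x0 = a i" using a0 by metis
    fix x y assume xy: "x \<in> V" "y \<in> V" "\<exists>i. x = a i" "adj x y"
    then obtain k where "x = a (Suc k)" using pred by metis
    then show "\<exists>i. y = a i" using NaS[of k] xy by (auto simp: N_def)
  qed (fact that)
  \<comment> \<open>Any index of \<open>x\<close> may be picked: by \<open>a_eqS\<close> the
    successor does not depend on it.\<close>
  define r where "r x = a (Suc (SOME i. a i = x))" for x
  have ra: "r (a i) = a (Suc i)" for i
    unfolding r_def a_eqS by (rule someI) simp
  have "r ` V = V"
  proof
    show "r ` V \<subseteq> V"
    proof
      fix y assume "y \<in> r ` V"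
      then obtain x where x: "x \<in> V" "y = r x" by blast
      obtain i where "x = a i" using all[OF x(1)] by blast
      then show "y \<in> V" using x ra aV by simp
    qed
    show "V \<subseteq> r ` V"
    proof
      fix y assume "y \<in> V"
      then obtain i where "y = a i" using all by blast
      moreover obtain k where "a i = a (Suc k)" using pred by blast
      ultimately have "y = r (a k)" by (simp add: ra)
      then show "y \<in> r ` V" using aV by blast
    qed
  qed
  then have "bij_betw r V V" using fin
    by (simp add: bij_betw_def eq_card_imp_inj_on)
  moreover have "adj x (r x)" if "x \<in> V" for x using all[OF that] ra aV by auto
  moreover have "adj (r x) (r y) \<longleftrightarrow> adj x y" if xy: "x \<in> V" "y \<in> V" for x y
  proof -
    obtain i l where i: "x = a i" "y = a l" using all xy by blast
    obtain k where "a i = a (Suc k)" using pred by blast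
    then have k: "x = a (Suc k)" "y = a l" using i by simp_all
    have "adj x y \<longleftrightarrow> a l = a k \<or> a l = a (Suc (Suc k))"
      using NaS[of k] k aV by (auto simp: N_def)
    moreover have "adj (r x) (r y) \<longleftrightarrow> a (Suc l) = a (Suc k) \<or> a (Suc l) = a (Suc (Suc (Suc k)))"
      using NaS[of "Suc k"] k aV by (auto simp: N_def ra)
    ultimately show ?thesis by (simp add: a_eqS)
  qed
  ultimately show ?thesis by (intro exI[of _ r] conjI ballI) simp_all
qed

subsection \<open>Connected face posets with a largest face\<close>

lemma face_poset_top:
  assumes K: "face_poset K" and T: "T \<in> K" "\<And>E. E \<in> K \<Longrightarrow> E \<subseteq> T"
  shows "K = Pow T - {{}}"
  using face_posetD[OF K] T by blast

lemma card_Pow_nonempty: "finite X \<Longrightarrow> card (Pow X - {{}}) = 2 ^ card X - 1"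
  by (simp add: card_Pow card_Diff_singleton)

text \<open>A \<open>k\<close>-set has \<open>2 ^ k - 1\<close> nonempty subsets, so the count
  determines \<open>k\<close>, and a bijection of the ground sets acts on their subsets.\<close>

lemma face_iso_of_card:
  assumes "finite T" "finite S" "card (Pow T - {{}}) = card (Pow S - {{}})"
  shows "\<exists>g. face_iso g (Pow T - {{}}) (Pow S - {{}})"
proof -
  have "(2::nat) ^ card T - 1 = 2 ^ card S - 1"
    using assms by (simp only: card_Pow_nonempty)
  then have "(2::nat) ^ card T = 2 ^ card S"
    by (rule eq_diff_iff[THEN iffD1, rotated 2]) simp_all
  then have "card T = card S" by simp
  then obtain h where h: "bij_betw h T S"
    using assms finite_same_card_bij by blast
  have "bij_betw ((`) h) (Pow T - {{}}) (Pow S - {{}})"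
    using bij_betw_Pow[OF h] by (rule bij_betw_DiffI) (auto simp: bij_betw_def)
  moreover have "h ` E \<subseteq> h ` F \<longleftrightarrow> E \<subseteq> F" if "E \<subseteq> T" "F \<subseteq> T" for E F
    using h that unfolding bij_betw_def inj_on_def by blast
  ultimately have "face_iso ((`) h) (Pow T - {{}}) (Pow S - {{}})" by (simp add: face_iso_def)
  then show ?thesis by blast
qed

text \<open>The setting for a single connected component, to which an isomorphism of comparability
  graphs has been restricted.\<close>

locale comparability_bij =
  fixes K :: "'a set set" and L :: "'b set set" and f :: "'a set \<Rightarrow> 'b set"
  assumes K: "face_poset K" and L: "face_poset L" and bij: "bij_betw f K L"
    and comp: "E \<in> K \<Longrightarrow> F \<in> K \<Longrightarrow> comparable (f E) (f F) \<longleftrightarrow> comparable E F"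
    and link: "linked comparable K"
begin

lemmas KD = face_posetD[OF K]
lemmas LD = face_posetD[OF L]

lemma singleton_in: "F \<in> K \<Longrightarrow> v \<in> F \<Longrightarrow> {v} \<in> K"
  using KD(4)[of F "{v}"] by auto

lemma f_eq: "E \<in> K \<Longrightarrow> F \<in> K \<Longrightarrow> f E = f F \<longleftrightarrow> E = F"
  using bij by (auto simp: bij_betw_def inj_on_def)

lemma f_in: "E \<in> K \<Longrightarrow> f E \<in> L"
  using bij by (auto simp: bij_betw_def)

lemma f_surj: "X \<in> L \<Longrightarrow> \<exists>E\<in>K. f E = X"
  using bij by (auto simp: bij_betw_def)

text \<open>Being comparable with every other face passes from \<open>T\<close> to
  \<open>f T\<close>. No singleton lies strictly above \<open>f T\<close>, so \<open>f T\<close>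
  contains all vertices of \<open>L\<close> and is its largest face. The isomorphism then comes from
  counting faces, not from \<open>f\<close>.\<close>

lemma with_top:
  assumes T: "T \<in> K" "\<And>E. E \<in> K \<Longrightarrow> E \<subseteq> T"
  shows "\<exists>g. face_iso g K L"
proof -
  have fT: "X \<subseteq> f T \<or> f T \<subset> X" if "X \<in> L" for X
  proof -
    obtain E where E: "E \<in> K" "f E = X" using f_surj \<open>X \<in> L\<close> by blast
    have "E = T \<or> comparable E T" using T E by (auto simp: comparable_def)
    then show ?thesis using comp[OF E(1) T(1)] E(2) by (auto simp: comparable_def)
  qed
  have fTL: "f T \<in> L" using f_in T by blast
  have "X \<subseteq> f T" if "X \<in> L" for X
  proof
    fix w assume "w \<in> X"
    then have "{w} \<in> L" using LD(4)[OF \<open>X \<in> L\<close>, of "{w}"] by auto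
    moreover have "\<not> f T \<subset> {w}" using LD(3)[OF fTL] by auto
    ultimately show "w \<in> f T" using fT by blast
  qed
  then have eqs: "L = Pow (f T) - {{}}" "K = Pow T - {{}}"
    using face_poset_top[OF L fTL] face_poset_top[OF K T] by blast+
  have "card (Pow T - {{}}) = card (Pow (f T) - {{}})"
    using bij_betw_same_card[OF bij] eqs by simp
  then show ?thesis
    using face_iso_of_card[OF KD(2)[OF T(1)] LD(2)[OF fTL]] eqs by simp
qed

subsection \<open>The direction of comparabilities\<close>

lemma comp_cases: "E \<in> K \<Longrightarrow> F \<in> K \<Longrightarrow> E \<subset> F \<Longrightarrow> f E \<subset> f F \<or> f F \<subset> f E"
  using comp[of E F] by (auto simp: comparable_def)

text \<open>If \<open>f\<close> preserved one of the inclusions and reversed the other,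
  \<open>f F\<close> would lie between \<open>f E\<close> and \<open>f E'\<close>, making
  \<open>E\<close> and \<open>E'\<close> comparable.\<close>

lemma direction_below:
  assumes "E \<in> K" "E' \<in> K" "F \<in> K" "E \<subset> F" "E' \<subset> F" "\<not> comparable E E'"
  shows "f E \<subset> f F \<longleftrightarrow> f E' \<subset> f F"
  using comp_cases[OF assms(1,3,4)] comp_cases[OF assms(2,3,5)] comp[OF assms(1,2)] assms(6)
  unfolding comparable_def by (metis psubset_trans)

text \<open>Order dual of \<open>direction_below\<close>: here \<open>f E\<close> would lie between
  \<open>f F\<close> and \<open>f F'\<close>.\<close>

lemma direction_above:
  assumes "E \<in> K" "F \<in> K" "F' \<in> K" "E \<subset> F" "E \<subset> F'" "\<not> comparable F F'"
  shows "f E \<subset> f F \<longleftrightarrow> f E \<subset> f F'"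
  using comp_cases[OF assms(1,2,4)] comp_cases[OF assms(1,3,5)] comp[OF assms(2,3)] assms(6)
  unfolding comparable_def by (metis psubset_trans)

text \<open>Vacuous for a singleton; hence the condition \<open>{v} \<subset> F\<close> in the
  lemmas that transfer it between faces.\<close>

definition upward :: "'a set \<Rightarrow> bool" where
  "upward F \<longleftrightarrow> (\<forall>E\<in>K. E \<subset> F \<longrightarrow> f E \<subset> f F)"

text \<open>Two proper faces of \<open>F\<close> are joined by a chain of pairwise incomparable ones
  through vertices of \<open>F\<close> missing from them.\<close>

lemma upward_iff:
  assumes "E \<in> K" "F \<in> K" "E \<subset> F"
  shows "f E \<subset> f F \<longleftrightarrow> upward F"
proof -
  have eq: "f E \<subset> f F \<longleftrightarrow> f E' \<subset> f F" if E': "E' \<in> K" "E' \<subset> F" for E'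
  proof -
    obtain x x' where x: "x \<in> F" "x \<notin> E" "x' \<in> F" "x' \<notin> E'" using assms E' by blast
    have sub: "{x} \<in> K" "{x} \<subset> F" "{x'} \<in> K" "{x'} \<subset> F"
      using singleton_in assms E' x KD(3)[of E] KD(3)[of E'] by auto
    have "\<not> comparable E {x}" "\<not> comparable {x} {x'}" "\<not> comparable {x'} E'"
      using x KD(3)[OF assms(1)] KD(3)[OF E'(1)] by (auto simp: comparable_def)
    then show ?thesis
      using direction_below[OF assms(1) sub(1) assms(2,3) sub(2)]
        direction_below[OF sub(1,3) assms(2) sub(2,4)]
        direction_below[OF sub(3) E'(1) assms(2) sub(4) E'(2)] by simp
  qed
  show ?thesis
  proof
    assume "f E \<subset> f F"
    then show "upward F" unfolding upward_def using eq by simp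
  next
    assume "upward F"
    then show "f E \<subset> f F" unfolding upward_def using assms by simp
  qed
qed

text \<open>Both directions can be read off at the common vertex, where
  \<open>direction_above\<close> equates them.\<close>

lemma upward_meet:
  assumes "F \<in> K" "H \<in> K" "{v} \<subset> F" "{v} \<subset> H" "\<not> comparable F H"
  shows "upward F \<longleftrightarrow> upward H"
proof -
  have "{v} \<in> K" using assms singleton_in by blast
  then show ?thesis
    using direction_above[of "{v}" F H] upward_iff[of "{v}" F] upward_iff[of "{v}" H] assms
    by simp
qed

text \<open>Otherwise the subfaces of \<open>F\<close> are closed under comparability, since a face
  comparable with one of them meets \<open>F\<close>. Connectedness then makes \<open>F\<close> the
  largest face.\<close>

lemma exists_crossing:
  assumes F: "F \<in> K" and notop: "\<not> (\<forall>E\<in>K. E \<subseteq> F)"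
  shows "\<exists>H\<in>K. H \<inter> F \<noteq> {} \<and> \<not> H \<subseteq> F"
proof (rule ccontr)
  assume *: "\<not> ?thesis"
  have "E \<subseteq> F" if "E \<in> K" for E
  proof (rule linkedD[OF link F, of "\<lambda>E. E \<subseteq> F"])
    fix x y assume "x \<in> K" "y \<in> K" "x \<subseteq> F" "comparable x y"
    then have "y \<inter> F \<noteq> {}" using KD(3)[of x] KD(3)[of y] by (auto simp: comparable_def)
    then show "y \<subseteq> F" using * \<open>y \<in> K\<close> by blast
  qed (use that in auto)
  then show False using notop by blast
qed

text \<open>A face \<open>H\<close> that meets \<open>M\<close> without lying in it is incomparable
  with the facet \<open>M\<close>, so \<open>M\<close> and \<open>H\<close> have the same direction.
  It remains to link \<open>F\<close> to \<open>H\<close> through incomparable faces with common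
  vertices.\<close>

lemma upward_facet:
  assumes notop: "\<not> (\<exists>T\<in>K. \<forall>E\<in>K. E \<subseteq> T)"
    and F: "F \<in> K" "{v} \<subset> F" and M: "M \<in> K" "F \<subset> M" "\<And>E. E \<in> K \<Longrightarrow> \<not> M \<subset> E"
  shows "upward F \<longleftrightarrow> upward M"
proof -
  have "\<not> (\<forall>E\<in>K. E \<subseteq> M)" using notop M by blast
  then obtain H u where H: "H \<in> K" "\<not> H \<subseteq> M" "u \<in> H" "u \<in> M"
    using exists_crossing[OF M(1)] by blast
  have MH: "\<not> comparable M H" using H M(3)[OF H(1)] by (auto simp: comparable_def)
  have sM: "{x} \<subset> M" if "x \<in> M" for x using that F M by blast
  have sF: "{x} \<subset> F" if "x \<in> F" for x using that F by blast
  have sH: "{x} \<subset> H" if "x \<in> H" "x \<in> M" for x using that H by blast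
  have upMH: "upward M \<longleftrightarrow> upward H"
    using upward_meet[OF M(1) H(1) sM sH MH] H by blast
  \<comment> \<open>In case \<open>cross\<close>, \<open>F\<close> and \<open>H\<close> are
    incomparable and meet. In the other cases an edge inside \<open>M\<close> mediates:
    \<open>{u, v}\<close> if \<open>F\<close> and \<open>H\<close> are disjoint,
    \<open>{v, b}\<close> with \<open>b\<close> in \<open>M - H\<close> if \<open>F\<close> lies in
    \<open>H\<close>.\<close>
  consider (out) "H \<inter> F = {}" | (cross) x where "x \<in> H" "x \<in> F" "\<not> F \<subseteq> H" | (within) "F \<subseteq> H"
    by blast
  then show ?thesis
  proof cases
    case out
    have v: "v \<in> F" "v \<in> M" "v \<notin> H" "u \<notin> F" "u \<noteq> v" using out F M H by auto
    have e: "{u, v} \<in> K" using KD(4)[OF M(1)] H v by auto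
    have "\<not> comparable F {u, v}" using v F by (auto simp: comparable_def)
    then have "upward F \<longleftrightarrow> upward {u, v}"
      using upward_meet[OF F(1) e, of v] F v by blast
    moreover have "\<not> comparable {u, v} H" using v H by (auto simp: comparable_def)
    then have "upward {u, v} \<longleftrightarrow> upward H"
      using upward_meet[OF e H(1), of u] sH v H by blast
    ultimately show ?thesis using upMH by blast
  next
    case cross
    then have "\<not> comparable F H" using H M by (auto simp: comparable_def)
    then show ?thesis
      using upward_meet[OF F(1) H(1) sF sH] cross upMH M by blast
  next
    case within
    obtain b where b: "b \<in> M" "b \<notin> H" using MH H by (auto simp: comparable_def)
    have v: "v \<in> F" "v \<in> M" "v \<in> H" "b \<notin> F" "b \<noteq> v" using within F M b by auto
    have e: "{v, b} \<in> K" using KD(4)[OF M(1)] b v by auto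
    have "\<not> comparable F {v, b}" using v F by (auto simp: comparable_def)
    then have "upward F \<longleftrightarrow> upward {v, b}"
      using upward_meet[OF F(1) e, of v] F v by blast
    moreover have "\<not> comparable {v, b} H" using v b H by (auto simp: comparable_def)
    then have "upward {v, b} \<longleftrightarrow> upward H"
      using upward_meet[OF e H(1), of v] sH v by blast
    ultimately show ?thesis using upMH by blast
  qed
qed

text \<open>Nested faces lie under one facet and both agree with it; incomparable ones agree through
  \<open>v\<close>.\<close>

lemma upward_local:
  assumes notop: "\<not> (\<exists>T\<in>K. \<forall>E\<in>K. E \<subseteq> T)"
    and F: "F \<in> K" "H \<in> K" "{v} \<subset> F" "{v} \<subset> H"
  shows "upward F \<longleftrightarrow> upward H"
proof -
  have sub: "upward E \<longleftrightarrow> upward G" if EG: "E \<in> K" "{v} \<subset> E" "G \<in> K" "E \<subset> G" for E G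
  proof -
    obtain M where M: "M \<in> K" "G \<subseteq> M" "\<forall>E\<in>K. M \<subseteq> E \<longrightarrow> M = E"
      using finite_has_maximal2[OF KD(1) EG(3)] by metis
    have max: "\<not> M \<subset> H" if "H \<in> K" for H using M(3) that by auto
    have sub: "E \<subset> M" "{v} \<subset> G" using EG M(2) by (metis psubset_subset_trans psubset_trans)+
    have "upward E \<longleftrightarrow> upward M"
      by (rule upward_facet[OF notop EG(1,2) M(1) sub(1) max])
    moreover have "upward G \<longleftrightarrow> upward M"
    proof (cases "G = M")
      case False
      then have "G \<subset> M" using M(2) by auto
      then show ?thesis by (rule upward_facet[OF notop EG(3) sub(2) M(1) _ max])
    qed simp
    ultimately show ?thesis by blast
  qed
  consider "F = H" | "F \<subset> H" | "H \<subset> F" | "\<not> comparable F H"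
    unfolding comparable_def by blast
  then show ?thesis
  proof cases
    case 2
    then show ?thesis by (rule sub[OF F(1,3,2)])
  next
    case 3
    then show ?thesis by (rule sub[OF F(2,4,1), symmetric])
  next
    case 4
    then show ?thesis by (rule upward_meet[OF F])
  qed simp
qed

text \<open>The direction is constant around each vertex by \<open>upward_local\<close>, and
  connectedness spreads it over \<open>K\<close>.\<close>

lemma monotone_or_antitone:
  assumes notop: "\<not> (\<exists>T\<in>K. \<forall>E\<in>K. E \<subseteq> T)"
  shows "(\<forall>E\<in>K. \<forall>F\<in>K. E \<subset> F \<longrightarrow> f E \<subset> f F) \<or> (\<forall>E\<in>K. \<forall>F\<in>K. E \<subset> F \<longrightarrow> f F \<subset> f E)"
proof (cases "\<exists>E0\<in>K. \<exists>F0\<in>K. E0 \<subset> F0")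
  case False
  then show ?thesis by blast
next
  case True
  then obtain E0 F0 where 0: "E0 \<in> K" "F0 \<in> K" "E0 \<subset> F0" by blast
  \<comment> \<open>The property concerns all larger faces at the vertices of \<open>x\<close>, so
    that it has content for a singleton \<open>x\<close> too, where \<open>upward x\<close> is
    vacuous.\<close>
  let ?P = "\<lambda>x. \<forall>F\<in>K. \<forall>v\<in>x. {v} \<subset> F \<longrightarrow> upward F = upward F0"
  have const: "?P x" if "x \<in> K" for x
  proof (rule linkedD[OF link 0(2), of ?P])
    have "{v} \<subset> F0" if "v \<in> F0" for v using 0 KD(3)[of E0] that by blast
    then show "?P F0" using upward_local[OF notop _ 0(2)] by blast
  next
    fix x y assume xy: "x \<in> K" "y \<in> K" "?P x" "comparable x y"
    show "?P y"
    proof (cases "y \<subset> x")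
      case True
      then show ?thesis using xy by blast
    next
      case False
      \<comment> \<open>A vertex of \<open>x\<close> lies in \<open>y\<close>, so \<open>y\<close>
        has the required direction, and \<open>upward_local\<close> carries it to all larger faces
        at the vertices of \<open>y\<close>.\<close>
      then have "x \<subset> y" using xy by (auto simp: comparable_def)
      moreover obtain u where "u \<in> x" using KD(3)[OF xy(1)] by blast
      ultimately have "{v} \<subset> y" if "v \<in> y" for v using that by blast
      moreover from this have "upward y = upward F0"
        using xy \<open>u \<in> x\<close> \<open>x \<subset> y\<close> by blast
      ultimately show ?thesis using upward_local[OF notop _ xy(2)] by blast
    qed
  qed (fact that)
  have up: "upward F = upward F0" if EF: "E \<in> K" "F \<in> K" "E \<subset> F" for E F
  proof -
    obtain v where "v \<in> E" using KD(3)[OF EF(1)] by blast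
    then have "v \<in> F" "{v} \<subset> F" using EF by auto
    then show ?thesis using const[OF EF(2)] EF(2) by blast
  qed
  show ?thesis
  proof (cases "upward F0")
    case True
    then have "\<forall>E\<in>K. \<forall>F\<in>K. E \<subset> F \<longrightarrow> f E \<subset> f F" using up upward_iff by metis
    then show ?thesis by (rule disjI1)
  next
    case False
    then have "\<forall>E\<in>K. \<forall>F\<in>K. E \<subset> F \<longrightarrow> f F \<subset> f E" using up upward_iff comp_cases by metis
    then show ?thesis by (rule disjI2)
  qed
qed

end

subsection \<open>Order-reversing bijections\<close>

locale antitone_bij = comparability_bij +
  assumes notop: "\<not> (\<exists>T\<in>K. \<forall>E\<in>K. E \<subseteq> T)"
    and anti: "E \<in> K \<Longrightarrow> F \<in> K \<Longrightarrow> E \<subset> F \<Longrightarrow> f F \<subset> f E"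
begin

lemma f_le: "E \<in> K \<Longrightarrow> F \<in> K \<Longrightarrow> f E \<subseteq> f F \<longleftrightarrow> F \<subseteq> E"
  using anti[of E F] anti[of F E] comp[of E F] f_eq[of E F]
  unfolding comparable_def by blast

section \<open>Stars and neighbourhoods of vertices\<close>

definition star :: "'a \<Rightarrow> 'a set set" where "star v = {E \<in> K. v \<in> E}"

text \<open>A closed neighbourhood: \<open>v\<close> itself belongs to it when \<open>{v}\<close> is
  a face, because \<open>{v, v} = {v}\<close>.\<close>

definition nb :: "'a \<Rightarrow> 'a set" where "nb v = {w. {v, w} \<in> K}"

text \<open>Under \<open>f\<close>, containing \<open>v\<close> turns into lying in
  \<open>f {v}\<close>, so the star corresponds to the nonempty subsets of
  \<open>f {v}\<close>.\<close>

lemma card_star: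
  assumes v: "{v} \<in> K"
  shows "card (star v) = 2 ^ card (f {v}) - 1"
proof -
  have "f ` star v = Pow (f {v}) - {{}}"
  proof
    show "f ` star v \<subseteq> Pow (f {v}) - {{}}"
      using f_le[OF _ v] LD(3) f_in by (fastforce simp: star_def)
    show "Pow (f {v}) - {{}} \<subseteq> f ` star v"
    proof
      fix X assume X: "X \<in> Pow (f {v}) - {{}}"
      then obtain E where "E \<in> K" "f E = X" using f_surj LD(4)[OF f_in[OF v]] by blast
      then show "X \<in> f ` star v" using X f_le[OF _ v, of E] by (auto simp: star_def)
    qed
  qed
  moreover have "inj_on f (star v)"
    using bij by (auto simp: bij_betw_def star_def intro: inj_on_subset)
  ultimately have "card (star v) = card (Pow (f {v}) - {{}})" by (metis card_image)
  then show ?thesis using LD(2)[OF f_in[OF v]] by (simp only: card_Pow_nonempty)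
qed

text \<open>If \<open>f {v}\<close> were a single vertex, the star of \<open>v\<close> would be
  \<open>{{v}}\<close>. Then \<open>{v}\<close> is isolated, connectedness gives
  \<open>K = {{v}}\<close>, and this has a largest face.\<close>

lemma two_le_card:
  assumes v: "{v} \<in> K"
  shows "2 \<le> card (f {v})"
proof (rule ccontr)
  assume "\<not> ?thesis"
  moreover have "card (f {v}) \<noteq> 0" using LD(2,3)[OF f_in[OF v]] by simp
  ultimately have "card (f {v}) = 1" by linarith
  then have "card (star v) = 1" using card_star[OF v] by simp
  moreover have "{v} \<in> star v" using v by (simp add: star_def)
  ultimately have st: "star v = {{v}}" by (auto simp: card_1_singleton_iff)
  have "E = {v}" if "E \<in> K" for E
  proof (rule linkedD[OF link v, of "\<lambda>E. E = {v}"])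
    fix x y assume "x = {v}" "y \<in> K" "comparable x y"
    then have "y \<in> star v" using KD(3)[of y] by (auto simp: comparable_def star_def)
    then show "y = {v}" using st by blast
  qed (use that in auto)
  then show False using notop v by blast
qed

text \<open>The edges at \<open>v\<close> cover \<open>{v}\<close>, so they correspond to the codimension one faces of
  \<open>f {v}\<close>.\<close>

lemma card_nb:
  assumes v: "{v} \<in> K"
  shows "card (nb v) = Suc (card (f {v}))" "finite (nb v)"
proof -
  have fv: "f {v} \<in> L" "finite (f {v})" using f_in v LD(2) by blast+
  have "(\<lambda>w. f {v, w}) ` (nb v - {v}) = (\<lambda>t. f {v} - {t}) ` f {v}"
  proof (intro equalityI subsetI)
    fix X assume "X \<in> (\<lambda>w. f {v, w}) ` (nb v - {v})"
    then obtain w where w: "{v, w} \<in> K" "w \<noteq> v" "X = f {v, w}" by (auto simp: nb_def)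
    then have ss: "X \<subset> f {v}" using anti[OF v, of "{v, w}"] by blast
    then obtain t where t: "t \<in> f {v}" "X \<subseteq> f {v} - {t}" by blast
    have "X \<noteq> {}" using w f_in LD(3) by blast
    \<comment> \<open>The preimage of \<open>f {v} - {t}\<close> lies between \<open>{v}\<close> and
      the edge \<open>{v, w}\<close> and differs from \<open>{v}\<close>, so it is the edge.\<close>
    then obtain E where E: "E \<in> K" "f E = f {v} - {t}"
      using t LD(4)[OF fv(1), of "f {v} - {t}"] f_surj by blast
    have "E \<subseteq> {v, w}" using f_le[OF w(1) E(1)] t E w by auto
    moreover have "{v} \<subseteq> E" using f_le[OF E(1) v] E by auto
    moreover have "E \<noteq> {v}" using E t by blast
    ultimately have "E = {v, w}" by blast
    then show "X \<in> (\<lambda>t. f {v} - {t}) ` f {v}" using E w t by auto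
  next
    fix X assume "X \<in> (\<lambda>t. f {v} - {t}) ` f {v}"
    then obtain t where t: "t \<in> f {v}" "X = f {v} - {t}" by blast
    have "card X \<noteq> 0" using two_le_card[OF v] t fv by simp
    then have "X \<noteq> {}" by auto
    then obtain E where E: "E \<in> K" "f E = X"
      using t LD(4)[OF fv(1), of X] f_surj by blast
    have vE: "{v} \<subseteq> E" using f_le[OF E(1) v] E t by auto
    moreover have "E \<noteq> {v}" using E t by blast
    ultimately obtain w where w: "w \<in> E" "w \<noteq> v" by blast
    then have e: "{v, w} \<in> K" using KD(4)[OF E(1), of "{v, w}"] vE by auto
    have "X \<subseteq> f {v, w}" using f_le[OF E(1) e] E w vE by auto
    moreover have "f {v, w} \<subset> f {v}" using anti[OF v e] w by blast
    ultimately have "X = f {v, w}" using t by blast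
    then show "X \<in> (\<lambda>w. f {v, w}) ` (nb v - {v})" using e w by (auto simp: nb_def)
  qed
  moreover have "inj_on (\<lambda>w. f {v, w}) (nb v - {v})"
    by (rule inj_onI) (auto simp: nb_def f_eq doubleton_eq_iff)
  moreover have "inj_on (\<lambda>t. f {v} - {t}) (f {v})" by (rule inj_onI) blast
  ultimately have c: "card (nb v - {v}) = card (f {v})" by (metis card_image)
  \<comment> \<open>Infinite sets have cardinality 0, so positivity yields finiteness.\<close>
  then have "card (nb v - {v}) > 0" using two_le_card[OF v] by simp
  then have "finite (nb v - {v})" by (rule card_ge_0_finite)
  then show fin: "finite (nb v)" by simp
  have "v \<in> nb v" using v by (simp add: nb_def)
  then show "card (nb v) = Suc (card (f {v}))"
    using card.remove[OF fin] c by simp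
qed

text \<open>The star of \<open>v\<close> has exactly one element less than the family of all sets between \<open>{v}\<close>
  and \<open>nb v\<close>, and it is closed under smaller members of that family.\<close>

lemma star_eq:
  assumes v: "{v} \<in> K"
  shows "star v = {E. v \<in> E \<and> E \<subset> nb v}" "nb v \<notin> K"
proof -
  let ?A = "{E. v \<in> E \<and> E \<subseteq> nb v}"
  have vn: "v \<in> nb v" using v by (simp add: nb_def)
  have "?A = insert v ` Pow (nb v - {v})"
  proof (intro equalityI subsetI)
    fix E assume "E \<in> ?A"
    then have "E = insert v (E - {v})" "E - {v} \<in> Pow (nb v - {v})" by auto
    then show "E \<in> insert v ` Pow (nb v - {v})" by blast
  qed (use vn in auto)
  moreover have "inj_on (insert v) (Pow (nb v - {v}))"
    by (rule inj_onI) (auto simp: insert_ident)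
  ultimately have "card ?A = 2 ^ card (nb v - {v})"
    using card_nb(2)[OF v] by (simp add: card_image card_Pow)
  then have cA: "card ?A = 2 ^ card (f {v})" using card_nb[OF v] vn by simp
  have finA: "finite ?A" using card_nb(2)[OF v] by simp
  have sub: "star v \<subseteq> ?A"
  proof
    fix E assume "E \<in> star v"
    then have "E \<in> K" "v \<in> E" by (auto simp: star_def)
    then show "E \<in> ?A" using KD(4)[of E "{v, w}" for w] by (auto simp: nb_def)
  qed
  \<comment> \<open>If \<open>nb v\<close> were a face, the star would be all of \<open>?A\<close>,
    but it is one set short of \<open>?A\<close>. So the missing set is the top one.\<close>
  show "nb v \<notin> K"
  proof
    assume "nb v \<in> K"
    then have "?A \<subseteq> star v" using KD(4)[of "nb v"] by (auto simp: star_def)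
    then have "2 ^ card (f {v}) = (2 ^ card (f {v}) - 1 :: nat)"
      using sub cA card_star[OF v] by (metis subset_antisym)
    moreover have "(2::nat) ^ card (f {v}) > 0" by simp
    ultimately show False by linarith
  qed
  then have "star v \<subseteq> ?A - {nb v}" using sub by (auto simp: star_def)
  moreover have "card (star v) = card (?A - {nb v})"
    using cA card_star[OF v] vn by (simp add: card_Diff_singleton)
  ultimately have "star v = ?A - {nb v}" using finA card_subset_eq by blast
  then show "star v = {E. v \<in> E \<and> E \<subset> nb v}" by auto
qed

text \<open>All proper subsets of \<open>W = nb v\<close> containing \<open>v\<close> are faces.
  Since \<open>W\<close> has at least four elements, triples are proper, so every vertex in
  \<open>W\<close> has closed neighbourhood \<open>W\<close>. Thus \<open>K\<close> is the boundary
  of the simplex on \<open>W\<close>, and complementation in \<open>W\<close> makes the antitone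
  \<open>f\<close> monotone.\<close>

lemma boundary_case:
  assumes v: "{v} \<in> K" and k: "3 \<le> card (f {v})"
  shows "\<exists>g. face_iso g K L"
proof -
  define W where "W = nb v"
  have cW: "card W \<ge> 4" using k card_nb[OF v] by (simp add: W_def)
  have WK: "W \<notin> K" using star_eq[OF v] by (simp add: W_def)
  have nb_W: "nb w = W \<and> {w} \<in> K" if w: "w \<in> W" for w
  proof -
    have "{v, w} \<in> K" using w by (simp add: W_def nb_def)
    then have wK: "{w} \<in> K" using KD(4)[of "{v, w}" "{w}"] by simp
    have "W \<subseteq> nb w"
    proof
      fix x assume x: "x \<in> W"
      have "card {v, w, x} \<le> 3" by (simp add: card_insert_if)
      then have "{v, w, x} \<noteq> W" using cW by auto
      moreover have "{v, w, x} \<subseteq> W" using w x v by (simp add: W_def nb_def)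
      ultimately have "{v, w, x} \<in> star v" unfolding star_eq(1)[OF v] W_def by blast
      then have "{w, x} \<in> K" using KD(4)[of "{v, w, x}" "{w, x}"] by (simp add: star_def)
      then show "x \<in> nb w" by (simp add: nb_def)
    qed
    \<comment> \<open>If \<open>nb w\<close> were larger than \<open>W\<close>, then
      \<open>W\<close> would belong to the star of \<open>w\<close>, against
      \<open>WK\<close>.\<close>
    then have "nb w = W" using star_eq[OF wK] w WK by (auto simp: star_def)
    then show ?thesis using wK by blast
  qed
  \<comment> \<open>A face that meets \<open>W\<close> in \<open>w\<close> belongs to the star of
    \<open>w\<close>, so it is a proper subset of \<open>W\<close>; connectedness leaves no other
    faces.\<close>
  have "E \<subset> W" if "E \<in> K" for E
  proof (rule linkedD[OF link v, of "\<lambda>E. E \<subset> W"])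
    have "v \<in> W" using v by (simp add: W_def nb_def)
    moreover have "{v} \<noteq> W" using cW by auto
    ultimately show "{v} \<subset> W" by blast
    fix x y assume xy: "x \<in> K" "y \<in> K" "x \<subset> W" "comparable x y"
    obtain w where w: "w \<in> x" "w \<in> W" using KD(3)[OF xy(1)] xy(3) by blast
    show "y \<subset> W"
    proof (cases "w \<in> y")
      case True
      then have "y \<in> star w" using xy by (simp add: star_def)
      then show ?thesis using star_eq(1)[of w] nb_W[OF w(2)] by auto
    next
      case False
      then show ?thesis using xy w by (auto simp: comparable_def)
    qed
  qed (fact that)
  moreover have "E \<in> K" if E: "E \<subset> W" "E \<noteq> {}" for E
  proof -
    obtain w where "w \<in> E" "w \<in> W" using E by blast
    then have "E \<in> star w" using star_eq(1)[of w] nb_W[of w] E by auto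
    then show ?thesis by (simp add: star_def)
  qed
  ultimately have Keq: "K = {E. E \<subset> W \<and> E \<noteq> {}}" using KD(3) by blast
  let ?c = "\<lambda>E. W - E"
  have "bij_betw ?c K K"
    by (rule bij_betw_byWitness[where f' = ?c]) (auto simp: Keq)
  then have "bij_betw (f \<circ> ?c) K L" using bij by (rule bij_betw_trans)
  moreover have "f (W - E) \<subseteq> f (W - F) \<longleftrightarrow> E \<subseteq> F" if "E \<in> K" "F \<in> K" for E F
  proof -
    have "W - E \<in> K" "W - F \<in> K" using that by (auto simp: Keq)
    then show ?thesis using f_le that by (auto simp: Keq)
  qed
  ultimately have "face_iso (f \<circ> ?c) K L" by (simp add: face_iso_def)
  then show ?thesis by blast
qed

text \<open>Each closed neighbourhood has three elements, so faces are vertices and edges, and the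
  comparability graph of a nonempty \<open>K\<close> is a cycle on which the two alternate. Rotating
  it by one step swaps them and reverses inclusion, so \<open>f \<circ> r\<close> preserves
  it.\<close>

lemma cycle_case:
  assumes two: "\<And>v. {v} \<in> K \<Longrightarrow> card (f {v}) = 2"
  shows "\<exists>g. face_iso g K L"
proof -
  have card_le: "card E < 3" if E: "E \<in> K" for E
  proof -
    obtain v where v: "v \<in> E" using KD(3)[OF E] by blast
    have vK: "{v} \<in> K" by (rule singleton_in[OF E v])
    have "E \<in> star v" using E v by (simp add: star_def)
    then have "E \<subset> nb v" using star_eq(1)[OF vK] by blast
    then have "card E < card (nb v)" by (rule psubset_card_mono[OF card_nb(2)[OF vK]])
    then show ?thesis using card_nb(1)[OF vK] two[OF vK] by simp
  qed
  have shape: "\<exists>v. x = {v} \<or> (\<exists>w. w \<noteq> v \<and> x = {v, w})" if "x \<in> K" for x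
  proof -
    have "card x \<noteq> 0" using KD(2,3)[OF that] by simp
    then have "card x = 1 \<or> card x = 2" using card_le[OF that] by linarith
    then show ?thesis by (auto simp: card_1_singleton_iff card_2_iff)
  qed
  have deg: "card {y \<in> K. comparable x y} = 2" if x: "x \<in> K" for x
  proof -
    obtain v where v: "x = {v} \<or> (\<exists>w. w \<noteq> v \<and> x = {v, w})" using shape[OF x] by blast
    then show ?thesis
    proof (elim disjE exE conjE)
      assume xv: "x = {v}"
      have "{y \<in> K. comparable x y} = star v - {{v}}"
        using xv KD(3) by (auto simp: comparable_def star_def)
      moreover have "card (star v) = 3" "{v} \<in> star v"
        using card_star[of v] two[of v] x xv by (auto simp: star_def)
      ultimately show ?thesis by simp
    next
      fix w assume w: "w \<noteq> v" "x = {v, w}"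
      have "\<not> x \<subset> y" if "y \<in> K" for y
        using psubset_card_mono[OF KD(2)[OF that], of x] card_le[OF that] w by auto
      then have "{y \<in> K. comparable x y} = {y \<in> K. y \<subset> x}" by (auto simp: comparable_def)
      also have "\<dots> = Pow {v, w} - {{}, {v, w}}"
        using w(2) KD(3) KD(4)[OF x] by blast
      also have "\<dots> = {{v}, {w}}"
        using w(1) by (auto simp: Pow_insert)
      finally show ?thesis using w by simp
    qed
  qed
  show ?thesis
  \<comment> \<open>The locale admits the empty poset, whereas the rotation needs a nonempty
    one.\<close>
  proof (cases "K = {}")
    case True
    then have "face_iso f K L" using bij by (simp add: face_iso_def)
    then show ?thesis by blast
  next
    case False
    obtain r where r: "bij_betw r K K" "\<And>x. x \<in> K \<Longrightarrow> comparable x (r x)"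
      "\<And>x y. x \<in> K \<Longrightarrow> y \<in> K \<Longrightarrow> comparable (r x) (r y) \<longleftrightarrow> comparable x y"
    proof -
      have "\<exists>r. bij_betw r K K \<and> (\<forall>x\<in>K. comparable x (r x)) \<and>
          (\<forall>x\<in>K. \<forall>y\<in>K. comparable (r x) (r y) \<longleftrightarrow> comparable x y)"
        by (rule two_regular_rotation[OF KD(1) False _ _ deg link]) (auto simp: comparable_def)
      then show thesis using that by blast
    qed
    have rK: "r x \<in> K" if "x \<in> K" for x using r(1) that by (auto simp: bij_betw_def)
    \<comment> \<open>Here \<open>x\<close> is a vertex and \<open>y\<close> an edge. The neighbour
      \<open>r y\<close> of \<open>y\<close> is a vertex, so no face is strictly below it, and
      \<open>r x\<close>, being comparable with it, lies above.\<close>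
    have flip: "r y \<subset> r x" if xy: "x \<in> K" "y \<in> K" "x \<subset> y" for x y
    proof -
      have "card x < card y" using psubset_card_mono[OF KD(2)] xy by blast
      moreover have "card x \<noteq> 0" using KD(2,3)[OF xy(1)] by simp
      ultimately have x1: "card x = 1" "card y = 2" using card_le[OF xy(2)] by auto
      have "\<not> r y \<subset> y \<longrightarrow> y \<subset> r y" using r(2)[OF xy(2)] by (auto simp: comparable_def)
      then have "r y \<subset> y"
        using psubset_card_mono[OF KD(2)[OF rK[OF xy(2)]], of y] card_le[OF rK[OF xy(2)]] x1
        by auto
      then have "card (r y) < 2" using psubset_card_mono[OF KD(2)[OF xy(2)]] x1 by metis
      moreover have "r x \<subset> r y \<longrightarrow> card (r x) < card (r y)"
        using psubset_card_mono[OF KD(2)[OF rK[OF xy(2)]]] by blast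
      moreover have "card (r x) \<noteq> 0" using KD(2,3)[OF rK[OF xy(1)]] by simp
      ultimately have "\<not> r x \<subset> r y" by linarith
      then show ?thesis using r(3)[OF xy(1,2)] xy by (auto simp: comparable_def)
    qed
    have "bij_betw (f \<circ> r) K L" using r(1) bij by (rule bij_betw_trans)
    moreover have "f (r x) \<subseteq> f (r y) \<longleftrightarrow> x \<subseteq> y" if xy: "x \<in> K" "y \<in> K" for x y
    proof -
      have "r x = r y \<longleftrightarrow> x = y" using r(1) xy by (auto simp: bij_betw_def inj_on_def)
      then have "r y \<subseteq> r x \<longleftrightarrow> x \<subseteq> y"
        using flip[of x y] flip[of y x] r(3)[of x y] xy unfolding comparable_def by blast
      then show ?thesis using f_le[OF rK rK] xy by blast
    qed
    ultimately have "face_iso (f \<circ> r) K L" by (simp add: face_iso_def)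
    then show ?thesis by blast
  qed
qed

lemma antitone_face_iso: "\<exists>g. face_iso g K L"
proof (cases "\<exists>v. {v} \<in> K \<and> 3 \<le> card (f {v})")
  case True
  then show ?thesis using boundary_case by blast
next
  case False
  then have "card (f {v}) = 2" if "{v} \<in> K" for v
    using two_le_card[OF that] that by fastforce
  then show ?thesis by (rule cycle_case)
qed

end

section \<open>Assembling the cases for one component\<close>

context comparability_bij
begin

lemma exists_face_iso: "\<exists>g. face_iso g K L"
proof (cases "\<exists>T\<in>K. \<forall>E\<in>K. E \<subseteq> T")
  case True
  then obtain T where "T \<in> K" "\<forall>E\<in>K. E \<subseteq> T" by blast
  then show ?thesis using with_top[of T] by simp
next
  case False
  from monotone_or_antitone[OF this] show ?thesis
  proof
    assume up: "\<forall>E\<in>K. \<forall>F\<in>K. E \<subset> F \<longrightarrow> f E \<subset> f F"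
    have "f E \<subseteq> f F \<longleftrightarrow> E \<subseteq> F" if "E \<in> K" "F \<in> K" for E F
      using up[rule_format, of E F] up[rule_format, of F E] comp[of E F] f_eq[of E F] that
      unfolding comparable_def by blast
    then have "face_iso f K L" using bij by (simp add: face_iso_def)
    then show ?thesis by blast
  next
    assume "\<forall>E\<in>K. \<forall>F\<in>K. E \<subset> F \<longrightarrow> f F \<subset> f E"
    then have "antitone_bij K L f" using False by unfold_locales simp_all
    then show ?thesis by (rule antitone_bij.antitone_face_iso)
  qed
qed

end

subsection \<open>Gluing connected components\<close>

text \<open>\<open>f\<close> may preserve inclusion on one component and reverse it on another, so
  each component gets its own order isomorphism onto its image under \<open>f\<close>. Faces of
  different components are incomparable on both sides, so the maps glue.\<close>

lemma face_iso_of_comparability: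
  fixes P :: "'a set set" and Q :: "'b set set"
  assumes P: "face_poset P" and Q: "face_poset Q" and f: "bij_betw f P Q"
    and comp: "\<And>E F. E \<in> P \<Longrightarrow> F \<in> P \<Longrightarrow> comparable (f E) (f F) \<longleftrightarrow> comparable E F"
  shows "\<exists>g. face_iso g P Q"
proof -
  define R where "R = {(x, y). x \<in> P \<and> y \<in> P \<and> comparable x y}\<^sup>*"
  define C where "C x = {y \<in> P. (x, y) \<in> R}" for x
  have symR: "(y, x) \<in> R" if "(x, y) \<in> R" for x y
    using that unfolding R_def
    by (rule symD[OF sym_rtrancl, rotated]) (auto simp: sym_def comparable_def)
  have transR: "(x, z) \<in> R" if "(x, y) \<in> R" "(y, z) \<in> R" for x y z
    using that unfolding R_def by (rule rtrancl_trans)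
  have stepR: "(x, y) \<in> R" if "x \<in> P" "y \<in> P" "comparable x y" for x y
    using that unfolding R_def by blast
  have reflR: "(x, x) \<in> R" for x unfolding R_def by blast
  have C_eq: "C x = C y" if "(x, y) \<in> R" for x y
    using that symR transR unfolding C_def by blast
  have inC: "x \<in> C x" if "x \<in> P" for x using that reflR by (simp add: C_def)
  have subC: "C x \<subseteq> P" for x by (auto simp: C_def)
  have step: "F \<in> C x" if "E \<in> C x" "F \<in> P" "comparable E F" for E F x
    using that stepR transR unfolding C_def by blast
  have "\<exists>g. face_iso g (C x) (f ` C x)" if "x \<in> P" for x
  proof -
    have "comparability_bij (C x) (f ` C x) f"
    proof
      show "face_poset (C x)"
        unfolding face_poset_def
      proof (intro conjI ballI allI impI)
        show "finite (C x)" using face_posetD(1)[OF P] subC finite_subset by blast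
        fix E assume E: "E \<in> C x"
        then have EP: "E \<in> P" using subC by blast
        then show "finite E" "E \<noteq> {}" using face_posetD[OF P] by blast+
        fix F assume F: "F \<subseteq> E" "F \<noteq> {}"
        then have "F \<in> P" using face_posetD(4)[OF P EP] by blast
        then show "F \<in> C x" using step[OF E, of F] F E by (cases "F = E") (auto simp: comparable_def)
      qed
      show "face_poset (f ` C x)"
        unfolding face_poset_def
      proof (intro conjI ballI allI impI)
        show "finite (f ` C x)" using face_posetD(1)[OF P] subC finite_subset by blast
        fix X assume "X \<in> f ` C x"
        then obtain E where E: "E \<in> C x" "X = f E" by blast
        then have EP: "E \<in> P" using subC by blast
        then have XQ: "X \<in> Q" using f E by (auto simp: bij_betw_def)
        then show "finite X" "X \<noteq> {}" using face_posetD[OF Q] by blast+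
        fix Y assume Y: "Y \<subseteq> X" "Y \<noteq> {}"
        then have "Y \<in> Q" using face_posetD(4)[OF Q XQ] by blast
        \<comment> \<open>A proper subface of \<open>f E\<close> is the image of a face comparable
          with \<open>E\<close>, hence of one in the same component.\<close>
        then obtain F where F: "F \<in> P" "Y = f F" using f by (auto simp: bij_betw_def)
        show "Y \<in> f ` C x"
        proof (cases "Y = X")
          case False
          then have "comparable (f E) (f F)" using Y E F by (auto simp: comparable_def)
          then have "F \<in> C x" using comp[OF EP F(1)] step[OF E(1) F(1)] by blast
          then show ?thesis using F by blast
        qed (use E in blast)
      qed
      show "bij_betw f (C x) (f ` C x)" using f subC by (rule bij_betw_subset) simp
      show "comparable (f E) (f F) \<longleftrightarrow> comparable E F" if "E \<in> C x" "F \<in> C x" for E F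
        using comp that subC by blast
      show "linked comparable (C x)"
        unfolding linked_def
      proof (intro allI impI)
        fix S assume S: "S \<subseteq> C x" "S \<noteq> {}" "\<forall>a\<in>S. \<forall>b\<in>C x. comparable a b \<longrightarrow> b \<in> S"
        then obtain a where a: "a \<in> S" by blast
        have "b \<in> S" if "(a, b) \<in> R" for b
          using that unfolding R_def
        proof (induction rule: rtrancl_induct)
          case (step y z)
          then have "y \<in> C x" "z \<in> P" "comparable y z" using S by auto
          then have "z \<in> C x" using \<open>\<And>x F E. E \<in> C x \<Longrightarrow> F \<in> P \<Longrightarrow> comparable E F \<Longrightarrow> F \<in> C x\<close> by blast
          then show ?case using S step by blast
        qed (fact a)
        moreover have "(a, b) \<in> R" if "b \<in> C x" for b
          using that a S symR transR unfolding C_def by blast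
        ultimately show "S = C x" using S by blast
      qed
    qed
    then show ?thesis by (rule comparability_bij.exists_face_iso)
  qed
  \<comment> \<open>\<open>G\<close> is indexed by the component, not by \<open>x\<close>, so that
    all faces of a component share one map.\<close>
  then obtain G where G: "\<And>x. x \<in> P \<Longrightarrow> face_iso (G (C x)) (C x) (f ` C x)"
  proof -
    assume ex: "\<And>x. x \<in> P \<Longrightarrow> \<exists>g. face_iso g (C x) (f ` C x)"
      and *: "\<And>G. (\<And>x. x \<in> P \<Longrightarrow> face_iso (G (C x)) (C x) (f ` C x)) \<Longrightarrow> thesis"
    show thesis
      by (rule *[of "\<lambda>D. SOME g. face_iso g D (f ` D)"]) (rule someI_ex[OF ex])
  qed
  define g where "g x = G (C x) x" for x
  have Gb: "bij_betw (G (C x)) (C x) (f ` C x)" if "x \<in> P" for x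
    using G[OF that] by (simp add: face_iso_def)
  have gC: "g x \<in> f ` C x" if "x \<in> P" for x
    using Gb[OF that] inC[OF that] by (auto simp: g_def bij_betw_def)
  have finj: "E = F" if "f E = f F" "E \<in> P" "F \<in> P" for E F
    using f that by (auto simp: bij_betw_def inj_on_def)
  have le: "g x \<subseteq> g y \<longleftrightarrow> x \<subseteq> y" if xy: "x \<in> P" "y \<in> P" for x y
  proof (cases "(x, y) \<in> R")
    case True
    then have "y \<in> C x" using xy by (simp add: C_def)
    then show ?thesis
      using G[OF xy(1)] inC[OF xy(1)] C_eq[OF True] by (simp add: face_iso_def g_def)
  next
    case False
    then have "\<not> x \<subseteq> y" using stepR[OF xy] reflR by (auto simp: comparable_def)
    \<comment> \<open>\<open>g x\<close> and \<open>g y\<close> are values of \<open>f\<close> on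
      the components of \<open>x\<close> and \<open>y\<close>; an inclusion between them would join
      these components.\<close>
    moreover have "\<not> g x \<subseteq> g y"
    proof
      assume le: "g x \<subseteq> g y"
      obtain a where a: "a \<in> C x" "g x = f a" using gC[OF xy(1)] by blast
      obtain b where b: "b \<in> C y" "g y = f b" using gC[OF xy(2)] by blast
      have ab: "a \<in> P" "b \<in> P" using a(1) b(1) subC by blast+
      have "a = b \<or> comparable a b"
        using le a b finj[OF _ ab] comp[OF ab] by (auto simp: comparable_def)
      then have "(a, b) \<in> R" using stepR[OF ab] reflR by auto
      moreover have "(x, a) \<in> R" "(b, y) \<in> R" using a b symR by (auto simp: C_def)
      ultimately have "(x, y) \<in> R" using transR by metis
      then show False using False by blast
    qed
    ultimately show ?thesis by blast
  qed
  have "inj_on g P" by (rule inj_onI) (use le in blast)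
  moreover have "g ` P = Q"
  proof
    show "g ` P \<subseteq> Q" using gC subC f by (fastforce simp: bij_betw_def)
    show "Q \<subseteq> g ` P"
    proof
      fix Y assume "Y \<in> Q"
      then obtain x where x: "x \<in> P" "Y = f x" using f by (auto simp: bij_betw_def)
      then have "Y \<in> G (C x) ` C x" using Gb[OF x(1)] inC by (auto simp: bij_betw_def)
      then obtain y where y: "y \<in> C x" "Y = G (C x) y" by blast
      then have "C x = C y" using C_eq by (auto simp: C_def)
      then show "Y \<in> g ` P" using y subC by (auto simp: g_def)
    qed
  qed
  ultimately have "face_iso g P Q" using le by (simp add: face_iso_def bij_betw_def)
  then show ?thesis by blast
qed

subsection \<open>From face posets to simplicial complexes\<close>

lemma simplicial_complexD:
  assumes "simplicial_complex n \<Delta>"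
  shows "E \<in> \<Delta> \<Longrightarrow> E \<subseteq> {1..n}" "i \<in> {1..n} \<Longrightarrow> {i} \<in> \<Delta>"
    "E \<in> \<Delta> \<Longrightarrow> F \<subseteq> E \<Longrightarrow> F \<in> \<Delta>" "{} \<in> \<Delta>"
proof -
  have n: "n \<ge> 1" and sub: "\<Delta> \<subseteq> Pow {1..n}" and vert: "\<forall>i\<in>{1..n}. {i} \<in> \<Delta>"
    and down: "\<forall>E\<in>\<Delta>. \<forall>F. F \<subseteq> E \<longrightarrow> F \<in> \<Delta>"
    using assms unfolding simplicial_complex_def by simp_all
  show "E \<in> \<Delta> \<Longrightarrow> E \<subseteq> {1..n}" using sub by blast
  show "i \<in> {1..n} \<Longrightarrow> {i} \<in> \<Delta>" using vert by simp
  show "E \<in> \<Delta> \<Longrightarrow> F \<subseteq> E \<Longrightarrow> F \<in> \<Delta>" using down by simp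
  \<comment> \<open>Positivity of \<open>n\<close> supplies a face, which has the empty set below
    it.\<close>
  have "{1} \<in> \<Delta>" using vert n by simp
  then show "{} \<in> \<Delta>" using down by blast
qed

lemma complex_isomorphic_of_face_iso:
  assumes 1: "simplicial_complex n1 \<Delta>1" and 2: "simplicial_complex n2 \<Delta>2"
    and g: "face_iso g (\<Delta>1 - {{}}) (\<Delta>2 - {{}})"
  shows "complex_isomorphic n1 \<Delta>1 n2 \<Delta>2"
proof -
  let ?P = "\<Delta>1 - {{}}" and ?Q = "\<Delta>2 - {{}}"
  note D1 = simplicial_complexD[OF 1]
  note D2 = simplicial_complexD[OF 2]
  have gim: "g ` ?P = ?Q" and gle: "\<And>E F. E \<in> ?P \<Longrightarrow> F \<in> ?P \<Longrightarrow> g E \<subseteq> g F \<longleftrightarrow> E \<subseteq> F"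
    using g by (auto simp: face_iso_def bij_betw_def)
  have gQ: "g E \<in> ?Q" if "E \<in> ?P" for E using gim that by blast
  have vert: "\<exists>j. g {i} = {j}" if i: "i \<in> {1..n1}" for i
  proof -
    have iP: "{i} \<in> ?P" using D1 i by blast
    then obtain j where j: "j \<in> g {i}" using gQ by blast
    then have "{j} \<in> ?Q" using D2(3)[of "g {i}" "{j}"] gQ[OF iP] by blast
    \<comment> \<open>Minimality of \<open>{i}\<close>: the preimage of a singleton below
      \<open>g {i}\<close> is a nonempty subset of \<open>{i}\<close>.\<close>
    then obtain E where E: "E \<in> ?P" "g E = {j}" using gim by (metis imageE)
    then have "E \<subseteq> {i}" using gle[OF E(1) iP] j by simp
    then have "E = {i}" using E by blast
    then show ?thesis using E by blast
  qed
  define h where "h i = the_elem (g {i})" for i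
  have h: "g {i} = {h i}" if "i \<in> {1..n1}" for i
  proof -
    obtain j where "g {i} = {j}" using vert[OF \<open>i \<in> {1..n1}\<close>] by blast
    then show ?thesis by (simp add: h_def)
  qed
  have hinv: "\<exists>i\<in>{1..n1}. h i = j \<and> g {i} = {j}" if j: "j \<in> {1..n2}" for j
  proof -
    have "{j} \<in> ?Q" using D2 j by blast
    then obtain E where E: "E \<in> ?P" "g E = {j}" using gim by (metis imageE)
    then obtain i where i: "i \<in> E" by blast
    then have i1: "i \<in> {1..n1}" using E D1 by blast
    then have "{i} \<in> ?P" using D1 by blast
    then have "g {i} \<subseteq> g E" using gle[OF _ E(1)] i by blast
    then show ?thesis using h[OF i1] E i1 by auto
  qed
  have gh: "g E = h ` E" if E: "E \<in> ?P" for E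
  proof (intro equalityI subsetI)
    fix j assume j: "j \<in> g E"
    then have "j \<in> {1..n2}" using gQ[OF E] D2 by blast
    then obtain i where i: "i \<in> {1..n1}" "h i = j" "g {i} = {j}" using hinv by blast
    have "{i} \<in> ?P" using D1(2) i(1) by blast
    moreover have "g {i} \<subseteq> g E" using i j by simp
    ultimately have "{i} \<subseteq> E" using gle[OF _ E] by blast
    then show "j \<in> h ` E" using i by auto
  next
    fix j assume "j \<in> h ` E"
    then obtain i where i: "i \<in> E" "j = h i" by blast
    then have i1: "i \<in> {1..n1}" using E D1 by blast
    then have "{i} \<in> ?P" using D1(2) by blast
    then have "g {i} \<subseteq> g E" using gle[OF _ E] i by simp
    then show "j \<in> g E" using h[OF i1] i by auto
  qed
  have "inj_on h {1..n1}"
  proof (rule inj_onI)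
    fix i j assume ij: "i \<in> {1..n1}" "j \<in> {1..n1}" "h i = h j"
    then have "g {i} \<subseteq> g {j}" using h by simp
    moreover have "{i} \<in> ?P" "{j} \<in> ?P" using D1(2) ij by blast+
    ultimately have "{i} \<subseteq> {j}" using gle by blast
    then show "i = j" by simp
  qed
  moreover have "h ` {1..n1} = {1..n2}"
  proof
    show "h ` {1..n1} \<subseteq> {1..n2}"
    proof
      fix j assume "j \<in> h ` {1..n1}"
      then obtain i where i: "i \<in> {1..n1}" "j = h i" by blast
      then have "g {i} \<in> ?Q" using gQ D1(2) by blast
      then have "{j} \<in> \<Delta>2" using h[OF i(1)] i by simp
      then show "j \<in> {1..n2}" using D2(1) by blast
    qed
    show "{1..n2} \<subseteq> h ` {1..n1}" using hinv by blast
  qed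
  ultimately have hb: "bij_betw h {1..n1} {1..n2}" by (simp add: bij_betw_def)
  \<comment> \<open>The empty face lies outside the domain of \<open>g\<close> and is treated
    separately.\<close>
  note empty = D1(4) D2(4)
  have "h ` E \<in> \<Delta>2" if "E \<in> \<Delta>1" for E
    using that gh[of E] gQ[of E] empty by (cases "E = {}") simp_all
  moreover have "h -` F \<inter> {1..n1} \<in> \<Delta>1" if F: "F \<in> \<Delta>2" for F
  proof (cases "F = {}")
    case False
    then obtain E where E: "E \<in> ?P" "g E = F" using gim F by (metis DiffI empty_iff imageE insertE)
    then have "F = h ` E" "E \<subseteq> {1..n1}" using gh D1 by auto
    then have "h -` F \<inter> {1..n1} = E"
      using \<open>inj_on h {1..n1}\<close> by (auto simp: inj_on_def)
    then show ?thesis using E by simp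
  qed (use empty in simp)
  ultimately show ?thesis
    using hb unfolding complex_isomorphic_def complex_isomorphism_def by blast
qed

section \<open>The theorem for simplicial complexes\<close>

lemma face_poset_simplicial_complex:
  assumes "simplicial_complex n \<Delta>"
  shows "face_poset (\<Delta> - {{}})"
  unfolding face_poset_def
proof (intro conjI ballI allI impI)
  note D = simplicial_complexD[OF assms]
  have "\<Delta> \<subseteq> Pow {1..n}" using D(1) by blast
  then have "finite \<Delta>" by (rule finite_subset) simp
  then show "finite (\<Delta> - {{}})" by simp
  fix E assume E: "E \<in> \<Delta> - {{}}"
  then have "E \<subseteq> {1..n}" using D(1) by blast
  then show "finite E" by (rule finite_subset) simp
  show "E \<noteq> {}" using E by simp
  fix F assume "F \<subseteq> E" "F \<noteq> {}"
  then show "F \<in> \<Delta> - {{}}" using D(3)[of E F] E by simp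
qed

text \<open>Both sides are symmetric in \<open>E\<close> and \<open>F\<close>, and both fail for
  \<open>E = F\<close>.\<close>

lemma comparability_graph_edge:
  assumes "E \<in> \<Delta> - {{}}" "F \<in> \<Delta> - {{}}"
  shows "{E, F} \<in> snd (comparability_graph \<Delta>) \<longleftrightarrow> comparable E F"
  using assms unfolding comparability_graph_def comparable_def
  by (auto simp: doubleton_eq_iff)

theorem theorem2p2:
  fixes n1 n2 :: nat and \<Delta>1 \<Delta>2 :: "nat set set"
  assumes "simplicial_complex n1 \<Delta>1"
    and "simplicial_complex n2 \<Delta>2"
    and "graph_isomorphic (comparability_graph \<Delta>1) (comparability_graph \<Delta>2)"
  shows "complex_isomorphic n1 \<Delta>1 n2 \<Delta>2"
proof -
  let ?P = "\<Delta>1 - {{}}" and ?Q = "\<Delta>2 - {{}}"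
  have fst: "fst (comparability_graph \<Delta>) = \<Delta> - {{}}" for \<Delta> :: "nat set set"
    by (simp add: comparability_graph_def)
  obtain f where f: "bij_betw f ?P ?Q"
    and edge: "\<And>E F. E \<in> ?P \<Longrightarrow> F \<in> ?P \<Longrightarrow>
      {E, F} \<in> snd (comparability_graph \<Delta>1) \<longleftrightarrow> {f E, f F} \<in> snd (comparability_graph \<Delta>2)"
    using assms(3) unfolding graph_isomorphic_def graph_isomorphism_def fst by blast
  have "comparable (f E) (f F) \<longleftrightarrow> comparable E F" if "E \<in> ?P" "F \<in> ?P" for E F
  proof -
    have "f E \<in> ?Q" "f F \<in> ?Q" using f that by (auto simp: bij_betw_def)
    then show ?thesis using edge[OF that] comparability_graph_edge that by metis
  qed
  then obtain g where "face_iso g ?P ?Q"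
    using face_iso_of_comparability[OF face_poset_simplicial_complex[OF assms(1)]
        face_poset_simplicial_complex[OF assms(2)] f] by blast
  then show ?thesis using complex_isomorphic_of_face_iso assms(1,2) by blast
qed

end
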